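(* Let $\mathcal{H}$ be a complex Hilbert space, let $T$ be an $EP$ operator on $\mathcal{H}$ and let $A,B\in\mathcal{B}(\mathcal{H})$. If $AT=TB$ and $BT=TA$, then $AT^\dagger=T^\dagger B$ and $BT^\dagger=T^\dagger A$.
   Context: $\mathcal{B}(\mathcal{H})$ is the space of bounded linear operators on $\mathcal{H}$; $\mathcal{R}(T)$ denotes the range of $T$ and $T^*$ its adjoint. For $T\in\mathcal{B}(\mathcal{H})$ with closed range, the Moore-Penrose inverse $T^\dagger$ is the unique operator in $\mathcal{B}(\mathcal{H})$ satisfying $TT^\dagger T=T$, $T^\dagger TT^\dagger=T^\dagger$, $TT^\dagger=(TT^\dagger)^*$ and $T^\dagger T=(T^\dagger T)^*$. An $EP$ operator on $\mathcal{H}$ is a $T\in\mathcal{B}(\mathcal{H})$ with closed range such that $\mathcal{R}(T)=\mathcal{R}(T^* )$. *)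

theory Defs
  imports "HOL-Analysis.Analysis"
begin

class complex_vector = real_vector +
  fixes scaleC :: "complex \<Rightarrow> 'a \<Rightarrow> 'a" (infixr \<open>*\<^sub>C\<close> 75)
  assumes scaleC_add_right: "c *\<^sub>C (x + y) = c *\<^sub>C x + c *\<^sub>C y"
    and scaleC_add_left: "(c + d) *\<^sub>C x = c *\<^sub>C x + d *\<^sub>C x"
    and scaleC_scaleC: "c *\<^sub>C (d *\<^sub>C x) = (c * d) *\<^sub>C x"
    and scaleC_one: "1 *\<^sub>C x = x"
    and scaleR_eq_scaleC: "r *\<^sub>R x = complex_of_real r *\<^sub>C x"

text \<open>The inner product is linear in the first argument. Its positive definiteness is contained
  in the last axiom: conjugate symmetry makes \<open>cinner x x\<close> real, and the norm axioms
  then force it to be nonnegative, and zero only for \<open>x = 0\<close>.\<close>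

class complex_inner = complex_vector + real_normed_vector +
  fixes cinner :: "'a \<Rightarrow> 'a \<Rightarrow> complex"
  assumes cinner_commute: "cinner y x = cnj (cinner x y)"
    and cinner_add_left: "cinner (x + y) z = cinner x z + cinner y z"
    and cinner_scaleC_left: "cinner (c *\<^sub>C x) y = c * cinner x y"
    and norm_eq_sqrt_cinner: "norm x = sqrt (Re (cinner x x))"

class chilbert_space = complex_inner + banach

instantiation complex :: chilbert_space
begin

definition scaleC_complex :: "complex \<Rightarrow> complex \<Rightarrow> complex"
  where "scaleC_complex c x = c * x"

definition cinner_complex :: "complex \<Rightarrow> complex \<Rightarrow> complex"
  where "cinner_complex x y = x * cnj y"

instance
proof
  fix x :: complex
  show "norm x = sqrt (Re (cinner x x))"
    by (simp add: cinner_complex_def cmod_def power2_eq_square)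
qed (simp_all add: scaleC_complex_def cinner_complex_def algebra_simps scaleR_conv_of_real)

end

definition bounded_clinear ::
    "('a::complex_inner \<Rightarrow> 'b::complex_inner) \<Rightarrow> bool"
  where "bounded_clinear T \<longleftrightarrow> bounded_linear T \<and> (\<forall>c x. T (c *\<^sub>C x) = c *\<^sub>C T x)"

text \<open>Between Hilbert spaces, the adjoint of a bounded complex-linear operator exists and is
  unique, and it is itself bounded and complex-linear. For other operators the value
  is unspecified.\<close>

definition cadjoint ::
    "('a::chilbert_space \<Rightarrow> 'b::chilbert_space) \<Rightarrow> 'b \<Rightarrow> 'a"
  where "cadjoint T = (THE S. \<forall>x y. cinner (T x) y = cinner x (S y))"

definition is_moore_penrose ::
    "('a::chilbert_space \<Rightarrow> 'a) \<Rightarrow> ('a \<Rightarrow> 'a) \<Rightarrow> bool"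
  where "is_moore_penrose T S \<longleftrightarrow> bounded_clinear S \<and>
    T \<circ> S \<circ> T = T \<and> S \<circ> T \<circ> S = S \<and>
    T \<circ> S = cadjoint (T \<circ> S) \<and> S \<circ> T = cadjoint (S \<circ> T)"

text \<open>Meaningful for bounded operators with closed range, where exactly one such operator
  exists.\<close>

definition moore_penrose :: "('a::chilbert_space \<Rightarrow> 'a) \<Rightarrow> 'a \<Rightarrow> 'a"
  where "moore_penrose T = (THE S. is_moore_penrose T S)"

definition EP_operator :: "('a::chilbert_space \<Rightarrow> 'a) \<Rightarrow> bool"
  where "EP_operator T \<longleftrightarrow>
    bounded_clinear T \<and> closed (range T) \<and> range T = range (cadjoint T)"

end

theory Submission imports Defs begin

text \<open>The orthogonal complement of the range of the adjoint of \<open>T\<close> is the kernel of \<open>T\<close>. For an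
  EP operator that range is also the closed range of \<open>T\<close>, so the space is the orthogonal sum of
  the range and the kernel of \<open>T\<close>. Hence \<open>T\<close> permutes its range bijectively, and its Moore-Penrose
  inverse \<open>S\<close> inverts this bijection and vanishes on the kernel. In particular \<open>T S\<close> and
  \<open>S T\<close> are the same operator, the orthogonal projection \<open>P\<close> onto the range
  (\<open>commuting_moore_penrose_exists\<close>).

  Once \<open>T S = S T = P\<close> is known, the rest is algebra (\<open>intertwines_commuting_inverse\<close>). The
  relations \<open>A T = T B\<close> and \<open>B T = T A\<close> make both \<open>A\<close> and \<open>B\<close> commute with \<open>P\<close>, and therefore
  \<open>A S = A P S = P A S = S T A S = S B T S = S B P = S P B = S B\<close>. The hypotheses are symmetric in
  \<open>A\<close> and \<open>B\<close>, which gives the second identity.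

  The analytic content is the existence of the projection and of adjoints, obtained from the
  parallelogram law and the Riesz representation, and the boundedness of \<open>S\<close>. The latter
  is a consequence of uniform boundedness (\<open>weakly_bounded_imp_bounded\<close>), because the equality of
  the two ranges supplies the pointwise bounds directly. Finally, the Moore-Penrose inverse is
  unique (\<open>is_moore_penrose_unique\<close>), so it is the operator \<open>S\<close> constructed here.\<close>

section \<open>Geometry of complex inner product spaces\<close>

lemma scaleC_minus_one: "(-1) *\<^sub>C x = - (x::'a::complex_vector)"
  using scaleR_eq_scaleC[of "-1" x] by simp

lemma cinner_minus_left: "cinner (- x) y = - cinner x (y::'a::complex_inner)"
  using cinner_scaleC_left[of "-1" x y] by (simp add: scaleC_minus_one)

lemma cinner_diff_left: "cinner (x - y) z = cinner x z - cinner y (z::'a::complex_inner)"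
  using cinner_add_left[of x "- y" z] by (simp add: cinner_minus_left)

lemma cinner_zero_left [simp]: "cinner 0 (y::'a::complex_inner) = 0"
  using cinner_diff_left[of 0 0 y] by simp

lemma cinner_add_right: "cinner x (y + z) = cinner x y + cinner x (z::'a::complex_inner)"
  by (simp add: cinner_commute[of x] cinner_add_left)

lemma cinner_diff_right: "cinner x (y - z) = cinner x y - cinner x (z::'a::complex_inner)"
  by (simp add: cinner_commute[of x] cinner_diff_left)

lemma cinner_scaleC_right: "cinner x (c *\<^sub>C y) = cnj c * cinner x (y::'a::complex_inner)"
  by (simp add: cinner_commute[of x] cinner_scaleC_left)

lemma cinner_zero_right [simp]: "cinner (x::'a::complex_inner) 0 = 0"
  using cinner_diff_right[of x 0 0] by simp

lemma cinner_eq_zero_commute: "cinner x y = 0 \<longleftrightarrow> cinner y (x::'a::complex_inner) = 0"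
  using cinner_commute[of x y] by simp

lemma Re_cinner_commute: "Re (cinner y x) = Re (cinner x (y::'a::complex_inner))"
  using arg_cong[OF cinner_commute[of y x], of Re] by simp

lemma Re_cinner_self: "Re (cinner x x) = (norm (x::'a::complex_inner))\<^sup>2"
proof -
  have "0 \<le> Re (cinner x x)"
    using norm_eq_sqrt_cinner[of x] norm_ge_zero[of x] by simp
  then show ?thesis
    by (simp add: norm_eq_sqrt_cinner)
qed

lemma cinner_self: "cinner x x = of_real ((norm (x::'a::complex_inner))\<^sup>2)"
proof -
  have "Im (cinner x x) = 0"
    using arg_cong[OF cinner_commute[of x x], of Im] by simp
  then show ?thesis
    by (simp add: complex_eq_iff Re_cinner_self)
qed

lemma cinner_self_eq_zero_iff: "cinner x x = 0 \<longleftrightarrow> x = (0::'a::complex_inner)"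
  by (simp add: cinner_self)

lemma norm_scaleC: "norm (c *\<^sub>C x) = cmod c * norm (x::'a::complex_inner)"
proof -
  have "cinner (c *\<^sub>C x) (c *\<^sub>C x) = (c * cnj c) * cinner x x"
    by (simp add: cinner_scaleC_left cinner_scaleC_right)
  also have "\<dots> = of_real ((cmod c * norm x)\<^sup>2)"
    by (simp add: cinner_self complex_norm_square[symmetric] power_mult_distrib del: complex_mult_cnj)
  finally show ?thesis
    by (simp add: norm_eq_sqrt_cinner[of "c *\<^sub>C x"])
qed

lemma norm_diff_square:
  "(norm (x - y))\<^sup>2 = (norm x)\<^sup>2 - 2 * Re (cinner x y) + (norm (y::'a::complex_inner))\<^sup>2"
  using Re_cinner_commute[of x y]
  by (simp add: Re_cinner_self[symmetric] cinner_diff_left cinner_diff_right)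

lemma norm_add_square:
  "(norm (x + y))\<^sup>2 = (norm x)\<^sup>2 + 2 * Re (cinner x y) + (norm (y::'a::complex_inner))\<^sup>2"
  using Re_cinner_commute[of x y]
  by (simp add: Re_cinner_self[symmetric] cinner_add_left cinner_add_right)

lemma parallelogram:
  "(norm (x + y))\<^sup>2 + (norm (x - y))\<^sup>2 = 2 * (norm x)\<^sup>2 + 2 * (norm (y::'a::complex_inner))\<^sup>2"
  by (simp add: norm_diff_square norm_add_square)

lemma Re_cinner_le: "Re (cinner x y) \<le> norm x * norm (y::'a::complex_inner)"
proof (cases "x = 0 \<or> y = 0")
  case False
  define a b where "a = norm x" and "b = norm y"
  have pos: "a * b > 0" using False by (simp add: a_def b_def)
  have "0 \<le> (norm (of_real b *\<^sub>C x - of_real a *\<^sub>C y))\<^sup>2" by simp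
  also have "\<dots> = 2 * (a * b) * (a * b - Re (cinner x y))"
    unfolding norm_diff_square norm_scaleC cinner_scaleC_left cinner_scaleC_right
    by (simp add: a_def[symmetric] b_def[symmetric]) (simp add: algebra_simps power2_eq_square)
  finally show ?thesis
    using pos by (simp add: zero_le_mult_iff a_def b_def)
qed auto

text \<open>Multiplying \<open>x\<close> by a unimodular scalar makes the inner product real and nonnegative,
  which reduces the estimate to that for real parts.\<close>

lemma Cauchy_Schwarz: "cmod (cinner x y) \<le> norm x * norm (y::'a::complex_inner)"
proof (cases "cinner x y = 0")
  case False
  define c where "c = cnj (sgn (cinner x y))"
  have c1: "cmod c = 1" using False by (simp add: c_def norm_sgn)
  have "c * cinner x y = of_real ((cmod (cinner x y))\<^sup>2 / cmod (cinner x y))"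
    by (simp add: c_def sgn_eq complex_norm_square[symmetric] mult.commute del: complex_mult_cnj)
  then have "c * cinner x y = of_real (cmod (cinner x y))"
    by (simp add: power2_eq_square)
  then have "cmod (cinner x y) = Re (cinner (c *\<^sub>C x) y)"
    by (simp add: cinner_scaleC_left)
  also have "\<dots> \<le> norm x * norm y"
    using Re_cinner_le[of "c *\<^sub>C x" y] by (simp add: norm_scaleC c1)
  finally show ?thesis .
qed simp

lemma bounded_linear_cinner_left: "bounded_linear (\<lambda>x. cinner x (y::'a::complex_inner))"
proof (rule bounded_linear_intro[where K = "norm y"])
  show "cinner (r *\<^sub>R x) y = r *\<^sub>R cinner x y" for r x
    by (simp add: scaleR_eq_scaleC[where 'a = 'a] cinner_scaleC_left scaleR_conv_of_real)
qed (simp_all add: cinner_add_left Cauchy_Schwarz)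

section \<open>Orthogonal projection, Riesz representation and adjoints\<close>

text \<open>By the parallelogram law applied to \<open>x - a\<close> and \<open>x - b\<close>, two nearly closest points
  of \<open>M\<close> are close to each other, because their midpoint lies in \<open>M\<close> too. Hence a minimising
  sequence is Cauchy.\<close>

lemma closest_point_exists:
  fixes M :: "'a::chilbert_space set"
  assumes "closed M" "M \<noteq> {}"
    and mid: "\<And>a b. a \<in> M \<Longrightarrow> b \<in> M \<Longrightarrow> (1/2) *\<^sub>R (a + b) \<in> M"
  obtains p where "p \<in> M" "\<And>m. m \<in> M \<Longrightarrow> norm (x - p) \<le> norm (x - m)"
proof -
  define D where "D = (INF m\<in>M. (norm (x - m))\<^sup>2)"
  have bdd: "bdd_below ((\<lambda>m. (norm (x - m))\<^sup>2) ` M)"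
    by (intro bdd_belowI2[where m = 0]) simp
  have D_le: "D \<le> (norm (x - m))\<^sup>2" if "m \<in> M" for m
    unfolding D_def using that bdd by (rule cINF_lower[rotated])
  have "\<exists>m\<in>M. (norm (x - m))\<^sup>2 < D + inverse (real (Suc n))" for n
    using cINF_less_iff[OF \<open>M \<noteq> {}\<close> bdd, of "D + inverse (real (Suc n))"]
    by (simp add: D_def)
  then obtain s where sM: "\<And>n. s n \<in> M"
    and s: "\<And>n. (norm (x - s n))\<^sup>2 < D + inverse (real (Suc n))"
    by metis
  have close: "(norm (s m - s n))\<^sup>2 \<le> 2 * inverse (real (Suc m)) + 2 * inverse (real (Suc n))" for m n
  proof -
    have "(x - s m) + (x - s n) = 2 *\<^sub>R (x - (1/2) *\<^sub>R (s m + s n))"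
      by (simp add: scaleR_2 algebra_simps)
    then have "(norm ((x - s m) + (x - s n)))\<^sup>2 = 4 * (norm (x - (1/2) *\<^sub>R (s m + s n)))\<^sup>2"
      by (simp add: power_mult_distrib)
    with D_le[OF mid[OF sM sM], of m n]
    have "4 * D \<le> (norm ((x - s m) + (x - s n)))\<^sup>2" by simp
    moreover have "(norm ((x - s m) - (x - s n)))\<^sup>2 = (norm (s m - s n))\<^sup>2"
      by (simp add: norm_minus_commute)
    ultimately show ?thesis
      using parallelogram[of "x - s m" "x - s n"] s[of m] s[of n] by linarith
  qed
  have "Cauchy s"
  proof (rule metric_CauchyI)
    fix e :: real assume "0 < e"
    then obtain N where N: "inverse (real (Suc N)) < e\<^sup>2 / 4"
      using reals_Archimedean[of "e\<^sup>2 / 4"] by auto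
    have "dist (s m) (s n) < e" if "m \<ge> N" "n \<ge> N" for m n
    proof -
      have "inverse (real (Suc m)) \<le> inverse (real (Suc N))"
        "inverse (real (Suc n)) \<le> inverse (real (Suc N))"
        using that by (auto intro!: le_imp_inverse_le)
      with close[of m n] N have "(norm (s m - s n))\<^sup>2 < e\<^sup>2" by linarith
      then show ?thesis
        using \<open>0 < e\<close> by (simp add: dist_norm power2_less_imp_less)
    qed
    then show "\<exists>N. \<forall>m\<ge>N. \<forall>n\<ge>N. dist (s m) (s n) < e" by blast
  qed
  then obtain p where p: "s \<longlonglongrightarrow> p"
    using Cauchy_convergent_iff convergent_def by blast
  have "p \<in> M"
    using closed_sequentially[OF \<open>closed M\<close>] sM p by blast
  moreover have "norm (x - p) \<le> norm (x - m)" if "m \<in> M" for m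
  proof (rule power2_le_imp_le)
    have "(\<lambda>n. D + inverse (real (Suc n))) \<longlonglongrightarrow> D + 0"
      by (intro tendsto_intros LIMSEQ_inverse_real_of_nat)
    then have "(norm (x - p))\<^sup>2 \<le> D + 0"
    proof (rule LIMSEQ_le[rotated])
      show "(\<lambda>n. (norm (x - s n))\<^sup>2) \<longlonglongrightarrow> (norm (x - p))\<^sup>2"
        by (intro tendsto_intros p)
    qed (use s less_imp_le in blast)
    with D_le[OF that] show "(norm (x - p))\<^sup>2 \<le> (norm (x - m))\<^sup>2" by linarith
  qed simp
  ultimately show ?thesis by (rule that)
qed

lemma orthogonal_projection_exists:
  fixes M :: "'a::chilbert_space set"
  assumes "closed M" and zero: "0 \<in> M"
    and add: "\<And>a b. a \<in> M \<Longrightarrow> b \<in> M \<Longrightarrow> a + b \<in> M"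
    and scale: "\<And>c a. a \<in> M \<Longrightarrow> c *\<^sub>C a \<in> M"
  obtains p where "p \<in> M" "\<And>m. m \<in> M \<Longrightarrow> cinner (x - p) m = 0"
proof -
  have "M \<noteq> {}" using zero by auto
  then obtain p where p: "p \<in> M" and min: "\<And>m. m \<in> M \<Longrightarrow> norm (x - p) \<le> norm (x - m)"
    using closest_point_exists[OF \<open>closed M\<close>] add scale scaleR_eq_scaleC by metis
  have "cinner (x - p) m = 0" if "m \<in> M" for m
  proof (cases "m = 0")
    case False
    \<comment> \<open>Moving \<open>p\<close> by the component of \<open>x - p\<close> along \<open>m\<close> removes that component from \<open>x - p\<close>;
      by minimality nothing may be gained, so the component is zero.\<close>
    define a where "a = cinner (x - p) m"
    define c where "c = a / of_real ((norm m)\<^sup>2)"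
    have "norm (x - p) \<le> norm ((x - p) - c *\<^sub>C m)"
      using min[OF add[OF p scale[OF that]], of c] by (simp add: algebra_simps)
    then have "(norm (x - p))\<^sup>2 \<le> (norm ((x - p) - c *\<^sub>C m))\<^sup>2"
      by (simp add: power_mono)
    then have "2 * Re (cnj c * a) \<le> (cmod c * norm m)\<^sup>2"
      by (simp add: norm_diff_square[of "x - p"] cinner_scaleC_right norm_scaleC a_def)
    moreover have "cnj c * a = of_real ((cmod a)\<^sup>2 / (norm m)\<^sup>2)"
      by (simp add: c_def complex_norm_square[symmetric] mult.commute del: complex_mult_cnj)
    moreover have "(cmod c * norm m)\<^sup>2 = (cmod a)\<^sup>2 / (norm m)\<^sup>2"
      using False
      by (simp add: c_def norm_divide norm_mult power_mult_distrib power_divide field_simps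
          del: of_real_power)
    ultimately have "(cmod a)\<^sup>2 / (norm m)\<^sup>2 \<le> 0"
      by (metis Re_complex_of_real mult_2 add_le_same_cancel1)
    then show ?thesis
      using False by (simp add: divide_le_0_iff a_def)
  qed simp
  with p show ?thesis by (rule that)
qed

text \<open>The representing vector is a multiple of a vector \<open>u\<close> orthogonal to the kernel of \<open>f\<close>: since
  \<open>f u *\<^sub>C x - f x *\<^sub>C u\<close> lies in the kernel, its inner product with \<open>u\<close> vanishes.\<close>

lemma Riesz_representation:
  fixes f :: "'a::chilbert_space \<Rightarrow> complex"
  assumes lin: "bounded_linear f" and scale: "\<And>c x. f (c *\<^sub>C x) = c * f x"
  obtains z where "\<And>x. f x = cinner x z"
proof (cases "\<forall>x. f x = 0")
  case True
  then show ?thesis using that[of 0] by simp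
next
  case False
  interpret f: bounded_linear f by (rule lin)
  obtain x0 where x0: "f x0 \<noteq> 0" using False by blast
  let ?K = "{x. f x = 0}"
  have "closed ?K"
    by (intro closed_Collect_eq continuous_intros linear_continuous_on lin)
  then obtain p where p: "f p = 0" and orth: "\<And>m. f m = 0 \<Longrightarrow> cinner (x0 - p) m = 0"
    using orthogonal_projection_exists[of ?K x0] by (auto simp: f.add f.zero scale)
  define u where "u = x0 - p"
  have fu: "f u \<noteq> 0" using x0 p by (simp add: u_def f.diff)
  then have nz: "cinner u u \<noteq> 0"
    using f.zero by (metis cinner_self_eq_zero_iff)
  define z where "z = cnj (f u / cinner u u) *\<^sub>C u"
  have "f x = cinner x z" for x
  proof -
    have "f (f u *\<^sub>C x - f x *\<^sub>C u) = 0" by (simp add: f.diff scale)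
    then have "cinner (f u *\<^sub>C x - f x *\<^sub>C u) u = 0"
      using orth cinner_eq_zero_commute unfolding u_def by blast
    then have "f u * cinner x u = f x * cinner u u"
      by (simp add: cinner_diff_left cinner_scaleC_left)
    then show ?thesis
      using nz by (simp add: z_def cinner_scaleC_right field_simps)
  qed
  then show ?thesis by (rule that)
qed

lemma cinner_ext: "(\<And>x. cinner x y = cinner x z) \<Longrightarrow> y = (z::'a::complex_inner)"
  by (metis cinner_diff_right cinner_self_eq_zero_iff right_minus_eq)

lemma cadjoint_eqI:
  assumes "\<And>x y. cinner (T x) y = cinner x (S y)"
  shows "cadjoint T = S"
  unfolding cadjoint_def
proof (rule the_equality)
  fix S' assume "\<forall>x y. cinner (T x) y = cinner x (S' y)"
  then show "S' = S"
    by (metis assms cinner_ext ext)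
qed (use assms in blast)

lemma cinner_cadjoint:
  assumes "bounded_clinear T"
  shows "cinner (T x) y = cinner x (cadjoint T y)"
proof -
  have T: "bounded_linear T" "\<And>c x. T (c *\<^sub>C x) = c *\<^sub>C T x"
    using assms by (auto simp: bounded_clinear_def)
  have "\<exists>z. \<forall>x. cinner (T x) y = cinner x z" for y
    using Riesz_representation[of "\<lambda>x. cinner (T x) y"]
      bounded_linear_compose[OF bounded_linear_cinner_left T(1)]
    by (metis T(2) cinner_scaleC_left)
  then obtain S where "\<And>x y. cinner (T x) y = cinner x (S y)" by metis
  then show ?thesis using cadjoint_eqI by metis
qed

section \<open>Uniform boundedness\<close>

text \<open>By the Baire category theorem one of the closed sets
  \<open>{z. \<forall>w\<in>W. cmod (cinner z w) \<le> n}\<close> contains a ball, and the difference of two points of that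
  ball can be any short vector, in particular a short multiple of an element of \<open>W\<close>.\<close>

lemma weakly_bounded_imp_bounded:
  fixes W :: "'a::chilbert_space set"
  assumes weak: "\<And>z. \<exists>C. \<forall>w\<in>W. cmod (cinner z w) \<le> C"
  shows "bounded W"
proof -
  define F where "F n = {z. \<forall>w\<in>W. cmod (cinner z w) \<le> real n}" for n :: nat
  have closedF: "closed (F n)" for n
  proof -
    have "closed {z. cmod (cinner z w) \<le> real n}" for w
      by (intro closed_Collect_le continuous_on_norm continuous_on_const
          linear_continuous_on[OF bounded_linear_cinner_left])
    then have "closed (\<Inter>w\<in>W. {z. cmod (cinner z w) \<le> real n})"
      by (intro closed_INT ballI)
    moreover have "F n = (\<Inter>w\<in>W. {z. cmod (cinner z w) \<le> real n})"
      by (auto simp: F_def)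
    ultimately show ?thesis by simp
  qed
  have "(\<Union>n. F n) = UNIV"
  proof -
    have "\<exists>n. z \<in> F n" for z
    proof -
      obtain C where "\<forall>w\<in>W. cmod (cinner z w) \<le> C" using weak by blast
      moreover obtain n where "C \<le> real n" using real_arch_simple by blast
      ultimately have "z \<in> F n" unfolding F_def by (auto intro: order_trans)
      then show ?thesis by (rule exI)
    qed
    then show ?thesis by auto
  qed
  then have "euclidean interior_of (\<Union>n. F n) \<noteq> {}"
    by simp
  then have "\<exists>n. interior (F n) \<noteq> {}"
    using Baire_category_alt[of euclidean "range F"] closedF
    by (auto simp: completely_metrizable_space_euclidean)
  then obtain n z0 e where "e > 0" and ball: "cball z0 e \<subseteq> F n"
    by (metis all_not_in_conv mem_interior_cball)
  have "norm w \<le> 2 * real n / e" if w: "w \<in> W" "w \<noteq> 0" for w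
  proof -
    define h where "h = (e / norm w) *\<^sub>R w"
    have "norm h = e" using \<open>e > 0\<close> w by (simp add: h_def)
    then have "z0 \<in> F n" "z0 + h \<in> F n"
      using ball \<open>e > 0\<close> by (auto simp: subset_iff dist_norm)
    then have "cmod (cinner z0 w) \<le> n" "cmod (cinner (z0 + h) w) \<le> n"
      using w by (auto simp: F_def)
    moreover have "cinner h w = cinner (z0 + h) w - cinner z0 w"
      by (simp add: cinner_add_left)
    ultimately have "cmod (cinner h w) \<le> 2 * real n"
      using norm_triangle_ineq4[of "cinner (z0 + h) w" "cinner z0 w"] by simp
    moreover have "cinner h w = of_real (e * norm w)"
      using w by (simp add: h_def scaleR_eq_scaleC cinner_scaleC_left cinner_self power2_eq_square)
    ultimately have "e * norm w \<le> 2 * real n"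
      using \<open>e > 0\<close> by (simp only: norm_of_real)
    then show ?thesis using \<open>e > 0\<close> by (simp add: field_simps)
  qed
  moreover have "norm (0::'a) \<le> 2 * real n / e"
    using \<open>e > 0\<close> by simp
  ultimately show ?thesis
    by (intro boundedI[where B = "2 * real n / e"]) metis
qed

section \<open>Moore-Penrose inverses\<close>

lemma bounded_clinear_compose:
  "bounded_clinear S \<Longrightarrow> bounded_clinear T \<Longrightarrow> bounded_clinear (S \<circ> T)"
  by (auto simp: bounded_clinear_def comp_def intro: bounded_linear_compose)

text \<open>The products \<open>E F = F\<close> and \<open>F E = E\<close> say that \<open>E\<close> and \<open>F\<close> have the same range; taking
  adjoints in one of them exchanges the factors and identifies the two projections.\<close>

lemma self_adjoint_idempotent_eqI:
  assumes "\<And>x y. cinner (E x) y = cinner x (E y)" "\<And>x y. cinner (F x) y = cinner x (F y)"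
    and EF: "\<And>x. E (F x) = F x" and FE: "\<And>x. F (E x) = E (x::'a::complex_inner)"
  shows "E = F"
proof (rule ext, rule cinner_ext)
  fix x y
  have "cinner y (E x) = cinner (E (F y)) x" by (simp add: assms(1,2) FE)
  also have "\<dots> = cinner y (F x)" by (simp add: assms(2) EF)
  finally show "cinner y (E x) = cinner y (F x)" .
qed

text \<open>Both \<open>T S1\<close> and \<open>T S2\<close> are the orthogonal projection onto the range of \<open>T\<close>, and both
  \<open>S1 T\<close> and \<open>S2 T\<close> are the one along its kernel, so
  \<open>S1 = S1 T S1 = S1 T S2 = S2 T S2 = S2\<close>.\<close>

lemma is_moore_penrose_unique:
  assumes T: "bounded_clinear T" and S1: "is_moore_penrose T S1" and S2: "is_moore_penrose T S2"
  shows "S1 = S2"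
proof -
  have clin: "bounded_clinear S1" "bounded_clinear S2"
    using S1 S2 by (auto simp: is_moore_penrose_def)
  have TST: "T (S1 (T x)) = T x" "T (S2 (T x)) = T x" for x
    using S1 S2 by (auto simp: is_moore_penrose_def fun_eq_iff)
  have STS: "S1 (T (S1 x)) = S1 x" "S2 (T (S2 x)) = S2 x" for x
    using S1 S2 by (auto simp: is_moore_penrose_def fun_eq_iff)
  have sa: "cinner (T (S1 x)) y = cinner x (T (S1 y))" "cinner (T (S2 x)) y = cinner x (T (S2 y))"
    "cinner (S1 (T x)) y = cinner x (S1 (T y))" "cinner (S2 (T x)) y = cinner x (S2 (T y))" for x y
    using cinner_cadjoint[OF bounded_clinear_compose[OF T clin(1)], of x y]
      cinner_cadjoint[OF bounded_clinear_compose[OF T clin(2)], of x y]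
      cinner_cadjoint[OF bounded_clinear_compose[OF clin(1) T], of x y]
      cinner_cadjoint[OF bounded_clinear_compose[OF clin(2) T], of x y]
      S1 S2 by (auto simp: is_moore_penrose_def fun_eq_iff)
  have TS: "(\<lambda>x. T (S1 x)) = (\<lambda>x. T (S2 x))"
    by (rule self_adjoint_idempotent_eqI) (simp_all add: sa TST)
  have ST: "S1 (T x) = S2 (T x)" for x
  proof -
    \<comment> \<open>For these two projections the first factor of a product survives, as in
      \<open>(S1 T) (S2 T) = S1 T\<close>, so the factors have to be exchanged by passing to adjoints.\<close>
    have "cinner y (S1 (T x)) = cinner y (S2 (T x))" for y
    proof -
      have "cinner y (S1 (T x)) = cinner y (S1 (T (S2 (T x))))" by (simp only: TST)
      also have "\<dots> = cinner (S2 (T (S1 (T y)))) x" by (simp only: sa)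
      also have "\<dots> = cinner y (S2 (T x))" by (simp only: TST sa)
      finally show ?thesis .
    qed
    then show ?thesis by (rule cinner_ext)
  qed
  show ?thesis
  proof
    fix x
    have "S1 x = S1 (T (S1 x))" by (simp only: STS)
    also have "\<dots> = S2 (T (S2 x))" by (simp only: fun_cong[OF TS] ST)
    finally show "S1 x = S2 x" by (simp only: STS)
  qed
qed

lemma moore_penrose_eqI:
  "bounded_clinear T \<Longrightarrow> is_moore_penrose T S \<Longrightarrow> moore_penrose T = S"
  unfolding moore_penrose_def by (rule the_equality) (simp_all add: is_moore_penrose_unique)

locale EP =
  fixes T :: "'a::chilbert_space \<Rightarrow> 'a"
  assumes EP: "EP_operator T"
begin

lemma bounded_clinear: "bounded_clinear T"
  using EP by (simp add: EP_operator_def)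

sublocale T: bounded_linear T
  using bounded_clinear by (simp add: bounded_clinear_def)

lemma scaleC: "T (c *\<^sub>C x) = c *\<^sub>C T x"
  using bounded_clinear by (simp add: bounded_clinear_def)

lemma range_eq: "range (cadjoint T) = range T"
  using EP by (simp add: EP_operator_def)

lemma adjoint: "cinner (T x) y = cinner x (cadjoint T y)"
  by (rule cinner_cadjoint[OF bounded_clinear])

lemma range_orthogonal_kernel: "T k = 0 \<Longrightarrow> y \<in> range T \<Longrightarrow> cinner k y = 0"
  by (auto simp: range_eq[symmetric] adjoint[symmetric])

lemma kernel_if_orthogonal_range: "(\<And>y. y \<in> range T \<Longrightarrow> cinner u y = 0) \<Longrightarrow> T u = 0"
  using adjoint[of u "T u"] by (simp add: range_eq[symmetric] cinner_self_eq_zero_iff)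

lemma range_kernel_zero: "y \<in> range T \<Longrightarrow> T y = 0 \<Longrightarrow> y = 0"
  using range_orthogonal_kernel cinner_self_eq_zero_iff by blast

lemma range_diff: "x \<in> range T \<Longrightarrow> y \<in> range T \<Longrightarrow> x - y \<in> range T"
  by (auto simp: T.diff[symmetric])

lemma range_add: "x \<in> range T \<Longrightarrow> y \<in> range T \<Longrightarrow> x + y \<in> range T"
  by (auto simp: T.add[symmetric])

lemma range_scaleC: "x \<in> range T \<Longrightarrow> c *\<^sub>C x \<in> range T"
  by (auto simp: scaleC[symmetric])

lemma range_kernel_decomposition:
  obtains p where "p \<in> range T" "T (x - p) = 0"
proof -
  have "closed (range T)" using EP unfolding EP_operator_def by blast
  moreover have "0 \<in> range T" by (metis T.zero rangeI)
  ultimately obtain p where "p \<in> range T" "\<And>m. m \<in> range T \<Longrightarrow> cinner (x - p) m = 0"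
    using orthogonal_projection_exists[of "range T" x] range_add range_scaleC by metis
  then show ?thesis using that kernel_if_orthogonal_range by blast
qed

text \<open>The vectors \<open>x / norm (T x)\<close> with \<open>x\<close> in the range are weakly bounded: they are
  orthogonal to the kernel, and their inner product with a vector \<open>cadjoint T b\<close> of the
  range has the same modulus as that of \<open>b\<close> with the unit vector \<open>T x / norm (T x)\<close>. Uniform
  boundedness thus does the work usually left to the open mapping theorem.\<close>

lemma bounded_below_on_range:
  obtains C where "C \<ge> 0" "\<And>x. x \<in> range T \<Longrightarrow> norm x \<le> C * norm (T x)"
proof -
  let ?w = "\<lambda>x. inverse (norm (T x)) *\<^sub>R x"
  have "bounded (?w ` range T)"
  proof (rule weakly_bounded_imp_bounded)
    fix z
    obtain p where p: "p \<in> range T" "T (z - p) = 0"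
      by (rule range_kernel_decomposition)
    then obtain b where b: "p = cadjoint T b" by (metis range_eq rangeE)
    have "cmod (cinner z (?w x)) \<le> norm b" if "x \<in> range T" for x
    proof -
      have "cinner z x = cinner p x"
        using range_orthogonal_kernel[OF p(2) that] by (simp add: cinner_diff_left)
      then have "cmod (cinner z x) = cmod (cinner (T x) b)"
        by (metis adjoint b cinner_commute complex_mod_cnj)
      also have "\<dots> \<le> norm (T x) * norm b" by (rule Cauchy_Schwarz)
      finally have "cmod (cinner z (?w x)) \<le> inverse (norm (T x)) * (norm (T x) * norm b)"
        by (simp add: scaleR_eq_scaleC cinner_scaleC_right norm_mult norm_inverse mult_left_mono
            del: of_real_inverse)
      also have "\<dots> \<le> norm b" by (cases "T x = 0") (auto simp: field_simps)
      finally show ?thesis .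
    qed
    then show "\<exists>C. \<forall>w\<in>?w ` range T. cmod (cinner z w) \<le> C" by blast
  qed
  then obtain C where "C > 0" and C: "\<And>x. x \<in> range T \<Longrightarrow> norm (?w x) \<le> C"
    unfolding bounded_pos by blast
  have "norm x \<le> C * norm (T x)" if "x \<in> range T" for x
  proof (cases "T x = 0")
    case True
    then show ?thesis using range_kernel_zero that by auto
  next
    case False
    then show ?thesis using C[OF that] by (simp add: field_simps)
  qed
  with \<open>C > 0\<close> show ?thesis by (intro that[of C]) auto
qed

text \<open>The value \<open>S x\<close> is the preimage, inside the range of \<open>T\<close>, of the projection of \<open>x\<close> onto that
  range. Both \<open>T (S x)\<close> and \<open>S (T x)\<close> lie in the range and differ from \<open>x\<close> by an element of the
  kernel; as range and kernel meet only in \<open>0\<close>, they coincide.\<close>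

lemma commuting_moore_penrose_exists:
  obtains S where "is_moore_penrose T S" "\<And>x. T (S x) = S (T x)"
proof -
  have "\<exists>y. y \<in> range T \<and> T (x - T y) = 0" for x
  proof -
    obtain p where p: "p \<in> range T" "T (x - p) = 0" by (rule range_kernel_decomposition)
    then obtain z where z: "p = T z" by blast
    obtain r where "r \<in> range T" "T (z - r) = 0" by (rule range_kernel_decomposition)
    with p z show ?thesis by (auto simp: T.diff)
  qed
  then obtain S where S_range: "\<And>x. S x \<in> range T" and S_ker: "\<And>x. T (x - T (S x)) = 0"
    by metis
  have S_eqI: "S x = y" if "y \<in> range T" "T (x - T y) = 0" for x y
  proof -
    have "T (T (S x - y)) = 0" using S_ker[of x] that(2) by (simp add: T.diff)
    then have "T (S x - y) = 0" by (rule range_kernel_zero[OF rangeI])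
    then have "S x - y = 0" by (rule range_kernel_zero[OF range_diff[OF S_range that(1)]])
    then show ?thesis by simp
  qed
  have S_add: "S (x + y) = S x + S y" for x y
    using S_ker[of x] S_ker[of y] by (intro S_eqI range_add S_range) (simp add: T.add T.diff)
  have S_scaleC: "S (c *\<^sub>C x) = c *\<^sub>C S x" for c x
    using S_ker[of x] by (intro S_eqI range_scaleC S_range) (simp add: scaleC T.diff)
  have TST: "T (S (T x)) = T x" for x
    using range_kernel_zero[OF range_diff S_ker, of "T x"] by simp
  have TS_ST: "T (S x) = S (T x)" for x
  proof -
    have "T (T (S x) - S (T x)) = 0"
      using S_ker[of x] by (simp add: T.diff TST)
    then have "T (S x) - S (T x) = 0" by (rule range_kernel_zero[OF range_diff[OF rangeI S_range]])
    then show ?thesis by simp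
  qed
  have STS: "S (T (S x)) = S x" for x
  proof -
    have "T (S (T (S x)) - S x) = 0" by (simp add: T.diff TST)
    then have "S (T (S x)) - S x = 0" by (rule range_kernel_zero[OF range_diff[OF S_range S_range]])
    then show ?thesis by simp
  qed
  have orth: "cinner (x - T (S x)) (T (S y)) = 0" for x y
    by (intro range_orthogonal_kernel S_ker) auto
  have sa: "cinner (T (S x)) y = cinner x (T (S y))" for x y
  proof -
    have "cinner (T (S x)) y = cinner (T (S x)) (T (S y))"
      using orth[of y x] cinner_eq_zero_commute[of "y - T (S y)"] by (simp add: cinner_diff_right)
    also have "\<dots> = cinner x (T (S y))"
      using orth[of x y] by (simp add: cinner_diff_left)
    finally show ?thesis .
  qed
  have contraction: "norm (T (S x)) \<le> norm x" for x
  proof (rule power2_le_imp_le)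
    have "(norm x)\<^sup>2 = (norm (x - T (S x)))\<^sup>2 + (norm (T (S x)))\<^sup>2"
      using norm_add_square[of "x - T (S x)" "T (S x)"] by (simp add: orth)
    then show "(norm (T (S x)))\<^sup>2 \<le> (norm x)\<^sup>2" by simp
  qed simp
  obtain C where "C \<ge> 0" and C: "\<And>x. x \<in> range T \<Longrightarrow> norm x \<le> C * norm (T x)"
    by (rule bounded_below_on_range) blast
  have "norm (S x) \<le> norm x * C" for x
    using C[OF S_range, of x] mult_left_mono[OF contraction \<open>C \<ge> 0\<close>, of x]
    by (simp add: mult.commute)
  then have "bounded_linear S"
    using S_add S_scaleC by (intro bounded_linear_intro) (auto simp: scaleR_eq_scaleC)
  then have "bounded_clinear S" using S_scaleC by (simp add: bounded_clinear_def)
  moreover have "cadjoint (T \<circ> S) = T \<circ> S" by (rule cadjoint_eqI) (simp add: sa)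
  moreover have "S \<circ> T = T \<circ> S" by (rule ext) (simp add: TS_ST)
  moreover have "T \<circ> S \<circ> T = T" "S \<circ> T \<circ> S = S" by (rule ext, simp add: TST STS)+
  ultimately have "is_moore_penrose T S"
    unfolding is_moore_penrose_def by (metis (no_types))
  then show ?thesis using TS_ST by (rule that)
qed

end

section \<open>Intertwining relations\<close>

text \<open>The projection \<open>T S = S T\<close> commutes with \<open>A\<close> and likewise with \<open>B\<close>: both
  \<open>A T S\<close> and \<open>S T A\<close> equal \<open>T S A T S\<close>, the first because \<open>A\<close> sends the range of \<open>T\<close> into itself, the second because it
  sends the kernel into itself. Sliding this projection past \<open>A\<close> gives
  \<open>A S = A T S S = S T A S = S B T S = S B\<close>.\<close>

lemma intertwines_commuting_inverse:
  assumes TST: "\<And>x. T (S (T x)) = T x" and STS: "\<And>x. S (T (S x)) = S x"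
    and comm: "\<And>x. T (S x) = S (T x)"
    and AT: "\<And>x. A (T x) = T (B x)" and BT: "\<And>x. B (T x) = T (A x)"
  shows "A (S x) = S (B x)"
proof -
  have TSA: "A (T (S x)) = T (S (A x))" for x
    by (metis AT BT TST comm)
  have TSB: "B (T (S x)) = T (S (B x))" for x
    by (metis AT BT TST comm)
  have "A (S x) = A (T (S (S x)))" by (metis STS comm)
  also have "\<dots> = S (T (A (S x)))" by (simp only: TSA) (simp only: comm)
  also have "\<dots> = S (B (T (S x)))" by (simp add: BT)
  also have "\<dots> = S (B x)" by (metis TSB STS)
  finally show ?thesis .
qed

theorem theorem3p20:
  fixes T A B :: "'a::chilbert_space \<Rightarrow> 'a"
  assumes "EP_operator T"
    and "bounded_clinear A" and "bounded_clinear B"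
    and "A \<circ> T = T \<circ> B" and "B \<circ> T = T \<circ> A"
  shows "A \<circ> moore_penrose T = moore_penrose T \<circ> B \<and>
    B \<circ> moore_penrose T = moore_penrose T \<circ> A"
proof -
  interpret EP T by unfold_locales (rule assms(1))
  obtain S where S: "is_moore_penrose T S" and comm: "\<And>x. T (S x) = S (T x)"
    by (rule commuting_moore_penrose_exists) blast
  have mp: "moore_penrose T = S"
    by (rule moore_penrose_eqI[OF bounded_clinear S])
  have TST: "T (S (T x)) = T x" and STS: "S (T (S x)) = S x" for x
    using S by (auto simp: is_moore_penrose_def fun_eq_iff)
  have AT: "A (T x) = T (B x)" and BT: "B (T x) = T (A x)" for x
    using assms(4,5) by (auto simp: fun_eq_iff)
  show ?thesis
    unfolding mp
    using intertwines_commuting_inverse[of T S A B, OF TST STS comm AT BT]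
      intertwines_commuting_inverse[of T S B A, OF TST STS comm BT AT]
    by (auto simp: fun_eq_iff)
qed

end
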